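(* Let $d,k\ge 1$, $c>0$ known, and let $(X,U,Y)\in\mathbb{R}^d\times\mathbb{R}^k\times\mathbb{R}^d$ have density $$\eta^{d+k/2}\,f\!\left(\eta\left(\|x-\theta\|^2+\|u\|^2+\|y-c\theta\|^2\right)\right)$$ with unknown $\theta\in\mathbb{R}^d$, $\eta>0$. Let $\hat\theta(X,U)$ be an estimator of $\theta$, and assume that the Kullback-Leibler risks and the expectations below are finite. Then the predictive density $$q_{\pi_0,\hat\theta}\sim T_d\!\left(k,\,c\,\hat\theta(X,U),\,\sqrt{\tfrac{(1+c^2)\|U\|^2}{k}}\right)$$ dominates the predictive density $$\hat q_{\pi_0}\sim T_d\!\left(k,\,cX,\,\sqrt{\tfrac{(1+c^2)\|U\|^2}{k}}\right)$$ under Kullback-Leibler loss if and only if $$\mathbb{E}_f\left[\log\left(\|Y-cX\|^2+(1+c^2)\|U\|^2\right)\right]\;\ge\;\mathbb{E}_f\left[\log\left(\|Y-c\hat\theta(X,U)\|^2+(1+c^2)\|U\|^2\right)\right]$$ for all $(\theta,\eta)$, with strict inequality for at least one $(\theta,\eta)$.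
   Context: $f:[0,\infty)\to[0,\infty)$ is a known function such that $t\mapsto f(\|t\|^2)$ is a probability density on $\mathbb{R}^{2d+k}$; $\mathbb{E}_f$ is expectation when $(X,U,Y)\in\mathbb{R}^d\times\mathbb{R}^k\times\mathbb{R}^d$ has density $\eta^{d+k/2}\,f\!\left(\eta\left(\|x-\theta\|^2+\|u\|^2+\|y-c\theta\|^2\right)\right)$ at parameter $(\theta,\eta)$. $T_d(\nu,\xi,\sigma)$ denotes the $d$-variate Student distribution with density $$\frac{1}{\sigma^d}\,\frac{\Gamma(\frac{\nu+d}{2})}{\Gamma(\frac{\nu}{2})(\pi\nu)^{d/2}}\left(1+\frac{\|t-\xi\|^2}{\nu\sigma^2}\right)^{-\frac{d+\nu}{2}},\quad t\in\mathbb{R}^d .$$ Let $q_{\theta,\eta}(\cdot|x,u)$ be the conditional density of $Y$ given $(X,U)=(x,u)$. The Kullback-Leibler risk of a predictive density $\hat q(\cdot;x,u)$ is $R_{KL}((\theta,\eta),\hat q)=\mathbb{E}^{X,U,Y}_{\theta,\eta}\log\frac{q_{\theta,\eta}(Y|X,U)}{\hat q(Y;X,U)}$. A predictive density $\hat q_1$ dominates $\hat q_0$ if $R_{KL}((\theta,\eta),\hat q_1)\le R_{KL}((\theta,\eta),\hat q_0)$ for all $(\theta,\eta)$, with strict inequality for at least one $(\theta,\eta)$. *)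

theory Defs
  imports "HOL-Probability.Probability"
begin

text \<open>
  The sample space is the Euclidean space \<open>(real^'d) \<times> (real^'k) \<times> (real^'d)\<close> of dimension \<open>2 d + k\<close>,
  with \<open>d = CARD('d) \<ge> 1\<close> and \<open>k = CARD('k) \<ge> 1\<close>; its norm satisfies
  \<open>(norm (x, u, y))\<^sup>2 = (norm x)\<^sup>2 + (norm u)\<^sup>2 + (norm y)\<^sup>2\<close>.
\<close>

definition spherical_density_generator :: "'a::euclidean_space itself \<Rightarrow> (real \<Rightarrow> real) \<Rightarrow> bool"
  where "spherical_density_generator _ f \<longleftrightarrow>
    (\<forall>s\<ge>0. f s \<ge> 0) \<and>
    (\<lambda>t::'a. f ((norm t)\<^sup>2)) \<in> borel_measurable borel \<and>
    (\<integral>\<^sup>+ t. ennreal (f ((norm (t::'a))\<^sup>2)) \<partial>lborel) = 1"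

definition model_density ::
  "(real \<Rightarrow> real) \<Rightarrow> real \<Rightarrow> real^'d \<Rightarrow> real \<Rightarrow> real^'d \<Rightarrow> real^'k \<Rightarrow> real^'d \<Rightarrow> real"
  where "model_density f c \<theta> \<eta> x u y =
    \<eta> powr (real CARD('d) + real CARD('k) / 2) *
      f (\<eta> * ((norm (x - \<theta>))\<^sup>2 + (norm u)\<^sup>2 + (norm (y - c *\<^sub>R \<theta>))\<^sup>2))"

definition model_law ::
  "(real \<Rightarrow> real) \<Rightarrow> real \<Rightarrow> real^'d \<Rightarrow> real \<Rightarrow> ((real^'d) \<times> (real^'k) \<times> (real^'d)) measure"
  where "model_law f c \<theta> \<eta> =
    density lborel (\<lambda>(x, u, y). ennreal (model_density f c \<theta> \<eta> x u y))"

text \<open>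
  The quotient takes the junk value \<open>0\<close> where the marginal density of \<open>(X, U)\<close> is \<open>0\<close> or infinite;
  this is a null set of the model law.
\<close>

definition cond_density ::
  "(real \<Rightarrow> real) \<Rightarrow> real \<Rightarrow> real^'d \<Rightarrow> real \<Rightarrow> real^'d \<Rightarrow> real^'d \<Rightarrow> real^'k \<Rightarrow> real"
  where "cond_density f c \<theta> \<eta> y x u =
    model_density f c \<theta> \<eta> x u y / (\<integral>y'. model_density f c \<theta> \<eta> x u y' \<partial>lborel)"

text \<open>A predictive density \<open>q\<close> is applied as \<open>q y x u\<close>, for the density at \<open>y\<close> given data \<open>(x, u)\<close>.\<close>

definition KL_log_ratio ::
  "(real \<Rightarrow> real) \<Rightarrow> real \<Rightarrow> (real^'d \<Rightarrow> real^'d \<Rightarrow> real^'k \<Rightarrow> real) \<Rightarrow> real^'d \<Rightarrow> real \<Rightarrow>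
    (real^'d) \<times> (real^'k) \<times> (real^'d) \<Rightarrow> real"
  where "KL_log_ratio f c q \<theta> \<eta> = (\<lambda>(x, u, y). ln (cond_density f c \<theta> \<eta> y x u / q y x u))"

definition KL_risk ::
  "(real \<Rightarrow> real) \<Rightarrow> real \<Rightarrow> (real^'d \<Rightarrow> real^'d \<Rightarrow> real^'k \<Rightarrow> real) \<Rightarrow> real^'d \<Rightarrow> real \<Rightarrow> real"
  where "KL_risk f c q \<theta> \<eta> = (\<integral>z. KL_log_ratio f c q \<theta> \<eta> z \<partial>model_law f c \<theta> \<eta>)"

text \<open>
  The Bochner integral is \<open>0\<close> for non-integrable integrands, so finiteness of the risk is
  expressed by integrability.
\<close>

definition finite_KL_risk ::
  "(real \<Rightarrow> real) \<Rightarrow> real \<Rightarrow> (real^'d \<Rightarrow> real^'d \<Rightarrow> real^'k \<Rightarrow> real) \<Rightarrow> real^'d \<Rightarrow> real \<Rightarrow> bool"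
  where "finite_KL_risk f c q \<theta> \<eta> \<longleftrightarrow> integrable (model_law f c \<theta> \<eta>) (KL_log_ratio f c q \<theta> \<eta>)"

definition KL_dominates ::
  "(real \<Rightarrow> real) \<Rightarrow> real \<Rightarrow> (real^'d \<Rightarrow> real^'d \<Rightarrow> real^'k \<Rightarrow> real) \<Rightarrow>
    (real^'d \<Rightarrow> real^'d \<Rightarrow> real^'k \<Rightarrow> real) \<Rightarrow> bool"
  where "KL_dominates f c q\<^sub>1 q\<^sub>0 \<longleftrightarrow>
    (\<forall>\<theta> \<eta>. \<eta> > 0 \<longrightarrow> KL_risk f c q\<^sub>1 \<theta> \<eta> \<le> KL_risk f c q\<^sub>0 \<theta> \<eta>) \<and>
    (\<exists>\<theta> \<eta>. \<eta> > 0 \<and> KL_risk f c q\<^sub>1 \<theta> \<eta> < KL_risk f c q\<^sub>0 \<theta> \<eta>)"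

definition student_density :: "real \<Rightarrow> 'a::euclidean_space \<Rightarrow> real \<Rightarrow> 'a \<Rightarrow> real"
  where "student_density \<nu> \<xi> \<sigma> t =
    1 / \<sigma> ^ DIM('a) *
    (Gamma ((\<nu> + real DIM('a)) / 2) / (Gamma (\<nu> / 2) * (pi * \<nu>) powr (real DIM('a) / 2))) *
    (1 + (norm (t - \<xi>))\<^sup>2 / (\<nu> * \<sigma>\<^sup>2)) powr (- (real DIM('a) + \<nu>) / 2)"

text \<open>The scale below vanishes only for \<open>u = 0\<close>, which is a null set of the model law.\<close>

definition student_predictive ::
  "real \<Rightarrow> (real^'d \<Rightarrow> real^'k \<Rightarrow> real^'d) \<Rightarrow> real^'d \<Rightarrow> real^'d \<Rightarrow> real^'k \<Rightarrow> real"
  where "student_predictive c \<delta> y x u =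
    student_density (real CARD('k)) (c *\<^sub>R \<delta> x u)
      (sqrt ((1 + c\<^sup>2) * (norm u)\<^sup>2 / real CARD('k))) y"

definition log_dispersion ::
  "real \<Rightarrow> (real^'d \<Rightarrow> real^'k \<Rightarrow> real^'d) \<Rightarrow> (real^'d) \<times> (real^'k) \<times> (real^'d) \<Rightarrow> real"
  where "log_dispersion c \<delta> =
    (\<lambda>(x, u, y). ln ((norm (y - c *\<^sub>R \<delta> x u))\<^sup>2 + (1 + c\<^sup>2) * (norm u)\<^sup>2))"

end

theory Submission
  imports Defs
begin

text \<open>
  Both predictive densities have the same degrees of freedom and the same scale, so in their log
  ratio everything cancels except \<open>(d + k) / 2\<close> times the difference of the log dispersions. The
  conditional density of \<open>Y\<close> cancels in the difference of the two risks because it is positive almost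
  surely; with the junk value of the quotient this needs Fubini, which makes the marginal density of
  \<open>(X, U)\<close> finite almost everywhere and positive almost surely.
\<close>

section \<open>Almost-everywhere statements and Fubini on nested products\<close>

lemma AE_lborel_pair:
  fixes P :: "'a::euclidean_space \<times> 'b::euclidean_space \<Rightarrow> bool"
  assumes "Measurable.pred borel P"
  shows "(AE z in lborel. P z) \<longleftrightarrow> (AE x in lborel. AE w in lborel. P (x, w))"
  using assms lborel_pair.AE_pair_iff[of "\<lambda>x w. P (x, w)", unfolded lborel_prod]
  by (simp add: pred_def)

lemma AE_lborel_triple:
  fixes P :: "'a::euclidean_space \<times> 'b::euclidean_space \<times> 'c::euclidean_space \<Rightarrow> bool"
  assumes [measurable]: "Measurable.pred borel P"
  shows "(AE z in lborel. P z) \<longleftrightarrow> (AE x in lborel. AE u in lborel. AE y in lborel. P (x, u, y))"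
  by (simp add: AE_lborel_pair)

text \<open>Fubini, applied once to each level of the nested product. For the model density it keeps
  the Bochner integral in the denominator of \<open>cond_density\<close> away from its default value
  0 for almost all \<open>x\<close> and \<open>u\<close>.\<close>

lemma AE_integrable_section:
  fixes g :: "'a::euclidean_space \<times> 'b::euclidean_space \<times> 'c::euclidean_space \<Rightarrow> real"
  assumes "integrable lborel g"
  shows "AE x in lborel. AE u in lborel. integrable lborel (\<lambda>y. g (x, u, y))"
proof -
  have "AE x in lborel. integrable lborel (\<lambda>w. g (x, w))"
    using assms lborel_pair.AE_integrable_fst'[of g] by (simp add: lborel_prod)
  then show ?thesis
  proof eventually_elim
    case (elim x)
    then show ?case
      using lborel_pair.AE_integrable_fst'[of "\<lambda>w. g (x, w)"] by (simp add: lborel_prod)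
  qed
qed

text \<open>A nonnegative integrable section with integral 0 vanishes almost everywhere, so the
  premise \<open>g (x, u, y) > 0\<close> fails for almost every \<open>y\<close>. Every other
  integrable section has positive integral.\<close>

lemma AE_section_integral_pos:
  fixes g :: "'a::euclidean_space \<times> 'b::euclidean_space \<times> 'c::euclidean_space \<Rightarrow> real"
  assumes g: "integrable lborel g" and nn: "\<And>z. g z \<ge> 0"
  shows "AE (x, u, y) in lborel. g (x, u, y) > 0 \<longrightarrow> (\<integral>y'. g (x, u, y') \<partial>lborel) > 0"
proof -
  have [measurable]: "g \<in> borel_measurable borel"
    using borel_measurable_integrable[OF g] by simp
  \<comment> \<open>Viewed as a function of the whole triple \<open>z\<close>, constant in its last
    component, the inner integral is measurable; the passage from iterated statements back to the
    triple requires this.\<close>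
  have "(\<lambda>(z, y'). g (fst z, fst (snd z), y')) \<in>
      borel_measurable ((borel :: ('a \<times> 'b \<times> 'c) measure) \<Otimes>\<^sub>M lborel)"
    unfolding borel_prod[symmetric] by measurable
  then have [measurable]: "(\<lambda>z. \<integral>y'. g (fst z, fst (snd z), y') \<partial>lborel) \<in>
      borel_measurable (borel :: ('a \<times> 'b \<times> 'c) measure)"
    by (rule lborel.borel_measurable_lebesgue_integral)
  have section_pos: "AE y in lborel. g (x, u, y) > 0 \<longrightarrow> (\<integral>y'. g (x, u, y') \<partial>lborel) > 0"
    if int: "integrable lborel (\<lambda>y. g (x, u, y))" for x u
  proof (cases "(\<integral>y'. g (x, u, y') \<partial>lborel) = 0")
    case True
    then have "AE y in lborel. g (x, u, y) = 0"
      using integral_nonneg_eq_0_iff_AE[OF int] nn by simp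
    then show ?thesis by eventually_elim simp
  next
    case False
    moreover have "(\<integral>y'. g (x, u, y') \<partial>lborel) \<ge> 0"
      using nn by simp
    ultimately show ?thesis by simp
  qed
  have "AE x in lborel. AE u in lborel. AE y in lborel.
      g (x, u, y) > 0 \<longrightarrow> (\<integral>y'. g (x, u, y') \<partial>lborel) > 0"
    using AE_integrable_section[OF g]
  proof (rule eventually_mono)
    fix x assume "AE u in lborel. integrable lborel (\<lambda>y. g (x, u, y))"
    then show "AE u in lborel. AE y in lborel.
        g (x, u, y) > 0 \<longrightarrow> (\<integral>y'. g (x, u, y') \<partial>lborel) > 0"
      by eventually_elim (rule section_pos)
  qed
  then have "AE z in lborel. g z > 0 \<longrightarrow> (\<integral>y'. g (fst z, fst (snd z), y') \<partial>lborel) > 0"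
    by (subst AE_lborel_triple) simp_all
  then show ?thesis by (simp add: case_prod_beta')
qed

section \<open>Integrability and almost sure regularity of the model law\<close>

lemma norm_sq_triple:
  "(norm (x, u, y))\<^sup>2 = (norm x)\<^sup>2 + (norm u)\<^sup>2 + (norm y)\<^sup>2"
  by (simp add: norm_Pair)

text \<open>Exhibits the density as the spherical one composed with an affine map, ready for a
  change of variables. The scale is \<open>sqrt \<eta>\<close> because the norm enters squared, and
  the centre has middle entry 0 because \<open>u\<close> is not shifted.\<close>

lemma model_density_affine:
  fixes \<theta> :: "real^'d" and u :: "real^'k"
  assumes "\<eta> > 0"
  shows "model_density f c \<theta> \<eta> x u y = \<eta> powr (real CARD('d) + real CARD('k) / 2) *
    f ((norm (sqrt \<eta> *\<^sub>R ((x, u, y) - (\<theta>, 0, c *\<^sub>R \<theta>))))\<^sup>2)"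
proof -
  have "(norm (sqrt \<eta> *\<^sub>R ((x, u, y) - (\<theta>, 0, c *\<^sub>R \<theta>))))\<^sup>2 =
      \<eta> * (norm ((x, u, y) - (\<theta>, 0, c *\<^sub>R \<theta>)))\<^sup>2"
    using assms by (simp only: norm_scaleR power_mult_distrib) simp
  then show ?thesis
    by (simp only: model_density_def diff_Pair norm_sq_triple diff_0_right)
qed

lemma integrable_model_density:
  fixes \<theta> :: "real^'d"
  assumes f: "spherical_density_generator TYPE((real^'d) \<times> (real^'k) \<times> (real^'d)) f"
    and \<eta>: "\<eta> > 0"
  shows "integrable lborel
    (\<lambda>(x, u, y). model_density f c \<theta> \<eta> x (u::real^'k) y)"
proof -
  let ?g = "\<lambda>t::(real^'d) \<times> (real^'k) \<times> (real^'d). f ((norm t)\<^sup>2)"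
  let ?m = "(\<theta>, 0, c *\<^sub>R \<theta>) :: (real^'d) \<times> (real^'k) \<times> (real^'d)"
  have [measurable]: "?g \<in> borel_measurable borel"
    and nn: "\<And>t. ?g t \<ge> 0" and one: "(\<integral>\<^sup>+ t. ennreal (?g t) \<partial>lborel) = 1"
    using f by (auto simp: spherical_density_generator_def)
  \<comment> \<open>Change of variables with Jacobian \<open>sqrt \<eta>\<close> to the power of the
    dimension. This factor is positive and the left side equals 1, so the integral on the right is
    finite.\<close>
  have "(\<integral>\<^sup>+ t. ennreal (?g t) \<partial>lborel) =
      ennreal (sqrt \<eta> ^ DIM((real^'d) \<times> (real^'k) \<times> (real^'d))) *
      (\<integral>\<^sup>+ z. ennreal (?g (- sqrt \<eta> *\<^sub>R ?m + sqrt \<eta> *\<^sub>R z)) \<partial>lborel)"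
    using \<eta> by (subst lborel_affine[of "sqrt \<eta>" "- sqrt \<eta> *\<^sub>R ?m"])
      (simp_all add: nn_integral_density nn_integral_distr nn_integral_cmult)
  also have "(\<lambda>z. - sqrt \<eta> *\<^sub>R ?m + sqrt \<eta> *\<^sub>R z) = (\<lambda>z. sqrt \<eta> *\<^sub>R (z - ?m))"
    by (simp only: scaleR_diff_right scaleR_minus_left uminus_add_conv_diff)
  finally have "(\<integral>\<^sup>+ z. ennreal (?g (sqrt \<eta> *\<^sub>R (z - ?m))) \<partial>lborel) < \<infinity>"
    using one \<eta> by (auto simp: less_top[symmetric] ennreal_mult_eq_top_iff)
  then have "integrable lborel (\<lambda>z. ?g (sqrt \<eta> *\<^sub>R (z - ?m)))"
    by (intro integrableI_nonneg AE_I2 nn) measurable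
  then have "integrable lborel
      (\<lambda>z. \<eta> powr (real CARD('d) + real CARD('k) / 2) * ?g (sqrt \<eta> *\<^sub>R (z - ?m)))"
    by (rule integrable_mult_right)
  then show ?thesis
    by (simp add: model_density_affine[OF \<eta>] case_prod_beta' del: diff_Pair)
qed

text \<open>Supplies the two conditions under which the logarithms split: a positive conditional
  density, and \<open>u \<noteq> 0\<close>, which makes the Student scale positive.\<close>

lemma AE_model_law_regular:
  fixes \<theta> :: "real^'d"
  assumes f: "spherical_density_generator TYPE((real^'d) \<times> (real^'k) \<times> (real^'d)) f"
    and \<eta>: "\<eta> > 0"
  shows "AE (x, u, y) in model_law f c \<theta> \<eta>.
    cond_density f c \<theta> \<eta> y x (u::real^'k) > 0 \<and> u \<noteq> 0"
proof -
  let ?p = "\<lambda>(x::real^'d, u::real^'k, y::real^'d). model_density f c \<theta> \<eta> x u y"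
  have int: "integrable lborel ?p"
    by (rule integrable_model_density[OF f \<eta>])
  have [measurable]: "?p \<in> borel_measurable borel"
    using borel_measurable_integrable[OF int] by simp
  have nn: "?p z \<ge> 0" for z
    using f \<eta> by (auto simp: model_density_def spherical_density_generator_def split: prod.split)
  have pos: "AE (x, u, y) in lborel. model_density f c \<theta> \<eta> x (u::real^'k) y > 0 \<longrightarrow>
      (\<integral>y'. model_density f c \<theta> \<eta> x u y' \<partial>lborel) > 0"
    using AE_section_integral_pos[OF int nn] by simp
  \<comment> \<open>The single point 0 is a Lebesgue null set in the space of
    \<open>u\<close>.\<close>
  have u: "AE z in lborel. fst (snd (z :: (real^'d) \<times> (real^'k) \<times> (real^'d))) \<noteq> 0"
  proof (subst AE_lborel_triple)
    have "AE u in lborel. AE y in (lborel :: (real^'d) measure). (u::real^'k) \<noteq> 0"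
      using AE_lborel_singleton by eventually_elim auto
    then show "AE x in lborel. AE u in lborel. AE y in lborel.
        fst (snd (x::real^'d, u::real^'k, y::real^'d)) \<noteq> 0"
      by simp
  qed (unfold borel_prod[symmetric], measurable)
  \<comment> \<open>Almost surely under a law with density \<open>?p\<close> means Lebesgue-almost
    everywhere where \<open>?p\<close> is positive. There the numerator of
    \<open>cond_density\<close> is positive, and by \<open>pos\<close> so is its
    denominator.\<close>
  have "AE z in lborel. ?p z > 0 \<longrightarrow>
      (case z of (x, u, y) \<Rightarrow> cond_density f c \<theta> \<eta> y x u > 0 \<and> u \<noteq> 0)"
    using pos u by eventually_elim (auto simp: cond_density_def)
  moreover have law: "model_law f c \<theta> \<eta> = density lborel (\<lambda>z. ennreal (?p z))"
    unfolding model_law_def by (intro arg_cong[of _ _ "density lborel"]) auto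
  ultimately show ?thesis
    unfolding law by (subst AE_density) auto
qed

section \<open>Logarithms of the Student predictive densities\<close>

lemma student_predictive_pos:
  fixes x y :: "real^'d" and u :: "real^'k"
  assumes "u \<noteq> 0"
  shows "student_predictive c \<delta> y x u > 0"
proof -
  have "1 + c\<^sup>2 > 0"
    by (simp add: add_pos_nonneg)
  then have "sqrt ((1 + c\<^sup>2) * (norm u)\<^sup>2 / real CARD('k)) > 0"
    using assms by simp
  then show ?thesis
    by (auto simp: student_predictive_def student_density_def add_pos_nonneg add_nonneg_eq_0_iff
        intro!: mult_pos_pos zero_less_power add_pos_pos divide_pos_pos Gamma_real_pos)
qed

text \<open>The normalizing constant and the scale do not depend on the point estimator, so they
  cancel. The estimators change sides in the equation because the Student kernel has a negative
  exponent.\<close>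

lemma ln_student_predictive_diff:
  fixes x y :: "real^'d" and u :: "real^'k"
  assumes u: "u \<noteq> 0"
  shows "ln (student_predictive c \<delta>\<^sub>0 y x u) - ln (student_predictive c \<delta>\<^sub>1 y x u) =
    (real CARD('d) + real CARD('k)) / 2 *
      (log_dispersion c \<delta>\<^sub>1 (x, u, y) - log_dispersion c \<delta>\<^sub>0 (x, u, y))"
proof -
  define S where "S = (1 + c\<^sup>2) * (norm u)\<^sup>2"
  define \<sigma> where "\<sigma> = sqrt (S / real CARD('k))"
  define K where "K = 1 / \<sigma> ^ CARD('d) * (Gamma ((real CARD('k) + real CARD('d)) / 2) /
    (Gamma (real CARD('k) / 2) * (pi * real CARD('k)) powr (real CARD('d) / 2)))"
  have "1 + c\<^sup>2 > 0"
    by (simp add: add_pos_nonneg)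
  then have S: "S > 0"
    using u by (simp add: S_def)
  then have "\<sigma> > 0"
    by (simp add: \<sigma>_def)
  then have K: "K > 0"
    by (auto simp: K_def intro!: mult_pos_pos divide_pos_pos Gamma_real_pos add_pos_pos)
  \<comment> \<open>The degrees of freedom cancel the division by \<open>k\<close> in the scale, so
    the kernel becomes a power of \<open>(N + S) / S\<close>, whose numerator is the argument of the
    log dispersion.\<close>
  have \<sigma>: "real CARD('k) * \<sigma>\<^sup>2 = S"
    using S by (simp add: \<sigma>_def)
  have "ln (student_predictive c \<delta> y x u) =
      ln K - (real CARD('d) + real CARD('k)) / 2 * (log_dispersion c \<delta> (x, u, y) - ln S)" for \<delta>
  proof -
    define N where "N = (norm (y - c *\<^sub>R \<delta> x u))\<^sup>2"
    have N: "N \<ge> 0"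
      by (simp add: N_def)
    have "student_predictive c \<delta> y x u =
        K * (1 + N / S) powr (- (real CARD('d) + real CARD('k)) / 2)"
      unfolding student_predictive_def student_density_def S_def[symmetric] \<sigma>_def[symmetric]
        \<sigma> N_def[symmetric] K_def by simp
    moreover have "1 + N / S = (N + S) / S"
      using S by (simp add: field_simps)
    moreover have "log_dispersion c \<delta> (x, u, y) = ln (N + S)"
      by (simp add: log_dispersion_def N_def S_def)
    ultimately show ?thesis
      using K S N by (simp add: ln_mult ln_powr ln_div field_simps)
  qed
  then show ?thesis
    by (simp only:) (simp add: field_simps)
qed

section \<open>Comparison of the two risks\<close>

text \<open>The predictive density stands in the denominator of the log ratio. Hence the difference
  of log ratios is almost surely \<open>ln\<close> of the density for
  \<open>\<delta>\<^sub>0\<close> minus \<open>ln\<close> of the one for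
  \<open>\<delta>\<^sub>1\<close>, and this is integrated.\<close>

lemma KL_risk_diff:
  fixes \<theta> :: "real^'d" and \<delta>\<^sub>0 \<delta>\<^sub>1 :: "real^'d \<Rightarrow> real^'k \<Rightarrow> real^'d"
  assumes f: "spherical_density_generator TYPE((real^'d) \<times> (real^'k) \<times> (real^'d)) f"
    and \<eta>: "\<eta> > 0"
    and risk: "finite_KL_risk f c (student_predictive c \<delta>\<^sub>0) \<theta> \<eta>"
      "finite_KL_risk f c (student_predictive c \<delta>\<^sub>1) \<theta> \<eta>"
    and disp: "integrable (model_law f c \<theta> \<eta>) (log_dispersion c \<delta>\<^sub>0)"
      "integrable (model_law f c \<theta> \<eta>) (log_dispersion c \<delta>\<^sub>1)"
  shows "KL_risk f c (student_predictive c \<delta>\<^sub>1) \<theta> \<eta> - KL_risk f c (student_predictive c \<delta>\<^sub>0) \<theta> \<eta> =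
    (real CARD('d) + real CARD('k)) / 2 *
      ((\<integral>z. log_dispersion c \<delta>\<^sub>1 z \<partial>model_law f c \<theta> \<eta>) -
       (\<integral>z. log_dispersion c \<delta>\<^sub>0 z \<partial>model_law f c \<theta> \<eta>))"
proof -
  let ?M = "model_law f c \<theta> \<eta> :: ((real^'d) \<times> (real^'k) \<times> (real^'d)) measure"
  let ?L = "\<lambda>\<delta>. KL_log_ratio f c (student_predictive c \<delta>) \<theta> \<eta>"
  note int = risk[unfolded finite_KL_risk_def]
  have "AE z in ?M. ?L \<delta>\<^sub>1 z - ?L \<delta>\<^sub>0 z = (real CARD('d) + real CARD('k)) / 2 *
      (log_dispersion c \<delta>\<^sub>1 z - log_dispersion c \<delta>\<^sub>0 z)"
    using AE_model_law_regular[OF f \<eta>, of c \<theta>]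
  proof eventually_elim
    case (elim z)
    obtain x u y where z: "z = (x, u, y)"
      by (cases z)
    have q: "cond_density f c \<theta> \<eta> y x u > 0" and u: "u \<noteq> 0"
      using elim by (simp_all add: z)
    have "?L \<delta> z = ln (cond_density f c \<theta> \<eta> y x u) - ln (student_predictive c \<delta> y x u)" for \<delta>
      using q student_predictive_pos[OF u, of c \<delta> y x]
      by (simp add: KL_log_ratio_def z ln_div)
    then show ?case
      using ln_student_predictive_diff[OF u, of c \<delta>\<^sub>0 y x \<delta>\<^sub>1] by (simp add: z)
  qed
  then have "(\<integral>z. ?L \<delta>\<^sub>1 z - ?L \<delta>\<^sub>0 z \<partial>?M) = (\<integral>z. (real CARD('d) + real CARD('k)) / 2 *
      (log_dispersion c \<delta>\<^sub>1 z - log_dispersion c \<delta>\<^sub>0 z) \<partial>?M)"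
    using int disp by (intro integral_cong_AE) auto
  \<comment> \<open>Integrability of each term allows both integrals to be split by
    linearity.\<close>
  then show ?thesis
    using int disp by (simp add: KL_risk_def)
qed

theorem lemma2p1:
  fixes f :: "real \<Rightarrow> real" and c :: real
    and \<theta>hat :: "real^'d \<Rightarrow> real^'k \<Rightarrow> real^'d"
  assumes "spherical_density_generator TYPE((real^'d) \<times> (real^'k) \<times> (real^'d)) f"
    and "c > 0"
    and "(\<lambda>(x, u). \<theta>hat x u) \<in> borel_measurable borel"
    and "\<And>\<theta> \<eta>. \<eta> > 0 \<Longrightarrow> finite_KL_risk f c (student_predictive c \<theta>hat) \<theta> \<eta>"
    and "\<And>\<theta> \<eta>. \<eta> > 0 \<Longrightarrow>
      finite_KL_risk f c (student_predictive c (\<lambda>(x::real^'d) (u::real^'k). x)) \<theta> \<eta>"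
    and "\<And>\<theta> \<eta>. \<eta> > 0 \<Longrightarrow> integrable (model_law f c \<theta> \<eta>) (log_dispersion c \<theta>hat)"
    and "\<And>\<theta> \<eta>. \<eta> > 0 \<Longrightarrow>
      integrable (model_law f c \<theta> \<eta>) (log_dispersion c (\<lambda>(x::real^'d) (u::real^'k). x))"
  shows "KL_dominates f c (student_predictive c \<theta>hat)
        (student_predictive c (\<lambda>(x::real^'d) (u::real^'k). x)) \<longleftrightarrow>
      (\<forall>\<theta> \<eta>. \<eta> > 0 \<longrightarrow>
        (\<integral>z. log_dispersion c (\<lambda>(x::real^'d) (u::real^'k). x) z \<partial>model_law f c \<theta> \<eta>)
          \<ge> (\<integral>z. log_dispersion c \<theta>hat z \<partial>model_law f c \<theta> \<eta>)) \<and>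
      (\<exists>\<theta> \<eta>. \<eta> > 0 \<and>
        (\<integral>z. log_dispersion c (\<lambda>(x::real^'d) (u::real^'k). x) z \<partial>model_law f c \<theta> \<eta>)
          > (\<integral>z. log_dispersion c \<theta>hat z \<partial>model_law f c \<theta> \<eta>))"
proof -
  let ?\<delta> = "\<lambda>(x::real^'d) (u::real^'k). x"
  let ?A = "(real CARD('d) + real CARD('k)) / 2"
  let ?D = "\<lambda>\<delta> \<theta> \<eta>. \<integral>z. log_dispersion c \<delta> z \<partial>model_law f c \<theta> \<eta>"
  \<comment> \<open>Positivity of this factor gives the risk difference the same sign as the
    dispersion difference. The non-strict comparison then yields the universal half of dominance,
    the strict one the existential half.\<close>
  have A: "?A > 0"
    by (simp add: add_pos_pos)
  have diff: "KL_risk f c (student_predictive c \<theta>hat) \<theta> \<eta> - KL_risk f c (student_predictive c ?\<delta>) \<theta> \<eta> =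
      ?A * (?D \<theta>hat \<theta> \<eta> - ?D ?\<delta> \<theta> \<eta>)" if "\<eta> > 0" for \<theta> \<eta>
    using assms that by (intro KL_risk_diff) auto
  have "KL_risk f c (student_predictive c \<theta>hat) \<theta> \<eta> \<le> KL_risk f c (student_predictive c ?\<delta>) \<theta> \<eta> \<longleftrightarrow>
      ?D \<theta>hat \<theta> \<eta> \<le> ?D ?\<delta> \<theta> \<eta>" if "\<eta> > 0" for \<theta> \<eta>
  proof -
    have "?A * (?D \<theta>hat \<theta> \<eta> - ?D ?\<delta> \<theta> \<eta>) \<le> 0 \<longleftrightarrow> ?D \<theta>hat \<theta> \<eta> - ?D ?\<delta> \<theta> \<eta> \<le> 0"
      using A by (simp only: mult_le_0_iff) auto
    with diff[OF that, of \<theta>] show ?thesis by linarith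
  qed
  moreover have "KL_risk f c (student_predictive c \<theta>hat) \<theta> \<eta> < KL_risk f c (student_predictive c ?\<delta>) \<theta> \<eta> \<longleftrightarrow>
      ?D \<theta>hat \<theta> \<eta> < ?D ?\<delta> \<theta> \<eta>" if "\<eta> > 0" for \<theta> \<eta>
  proof -
    have "?A * (?D \<theta>hat \<theta> \<eta> - ?D ?\<delta> \<theta> \<eta>) < 0 \<longleftrightarrow> ?D \<theta>hat \<theta> \<eta> - ?D ?\<delta> \<theta> \<eta> < 0"
      using A by (simp only: mult_less_0_iff) auto
    with diff[OF that, of \<theta>] show ?thesis by linarith
  qed
  ultimately show ?thesis
    unfolding KL_dominates_def by blast
qed

end
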